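(* For any $\widehat H\in\mathcal F_\diamond$ the limit $\lim_{\delta\to+\infty}\phi^\delta_{\xi_*}(\widehat H)$ exists in the product topology on $\mathcal F_\diamond$ and lies in $\mathcal N_\diamond$.
   Context: Fix $n\ge1$ and a vector $\omega\in\mathbb R^n$. $\mathbb Z_+=\{0,1,2,\dots\}$. For $\mathbf k=(k,\overline k)\in\mathbb Z_+^{2n}$, with $k,\overline k\in\mathbb Z_+^n$, put $|\mathbf k|=\sum_j(k_j+\overline k_j)$ and $\mathbf k'=\overline k-k\in\mathbb Z^n$. Put $\mathbb Z^{2n}_\diamond=\{\mathbf k\in\mathbb Z_+^{2n}:|\mathbf k|\ge3\}$, $\mathbb L_\omega=\{q\in\mathbb Z^n:\langle\omega,q\rangle=0\}$, and $\sigma_q=\operatorname{sign}\langle\omega,q\rangle\in\{-1,0,1\}$ for $q\in\mathbb Z^n$. The variables $\mathbf z=(z,\overline z)=(z_1,\dots,z_n,\overline z_1,\dots,\overline z_n)$ are $2n$ independent variables (the bar is not conjugation), and $\mathbf z^{\mathbf k}=z^k\overline z^{\overline k}$. $\mathcal F=\mathbb C[[z,\overline z]]$ is the space of formal power series $H=\sum_{\mathbf k}H_{\mathbf k}\mathbf z^{\mathbf k}$; $\mathcal F_\diamond\subset\mathcal F$ is the subspace of series with $H_{\mathbf k}=0$ for $|\mathbf k|\le2$; $\mathcal N_\diamond$ is the subspace of those $H\in\mathcal F_\diamond$ such that $H_{\mathbf k}\ne0$ implies $\mathbf k'\in\mathbb L_\omega$. The product topology is the topology of convergence of each coefficient $H_{\mathbf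 k}$. The Poisson bracket is $\{F,G\}=i\sum_{j=1}^n(\partial_{\overline z_j}F\,\partial_{z_j}G-\partial_{z_j}F\,\partial_{\overline z_j}G)$, and $H_2=\sum_{j=1}^n\omega_jz_j\overline z_j$. The operator $\xi_*$ on $\mathcal F_\diamond$ is $\xi_*H=-i\sum_{\mathbf k\in\mathbb Z^{2n}_\diamond}\sigma_{\mathbf k'}H_{\mathbf k}\mathbf z^{\mathbf k}$. $\phi^\delta_{\xi_*}(\widehat H)=H(\cdot,\delta)$ denotes the (unique) solution of the initial value problem in $\mathcal F_\diamond$ $$\partial_\delta H=-\{\xi_*H,\,H_2+H\},\qquad H|_{\delta=0}=\widehat H,$$ understood coefficientwise (the ODEs for the Taylor coefficients $H_{\mathbf k}(\delta)$ obtained by equating the coefficients of each $\mathbf z^{\mathbf k}$); it exists for all $\delta\in\mathbb R$. *)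

theory Defs
  imports "HOL-Analysis.Analysis"
begin

text \<open>
  The dimension \<open>n \<ge> 1\<close> is the cardinality of the finite index type \<open>'n\<close>. A multi-index
  is a pair \<open>(k, kb)\<close>, with \<open>k\<close> the exponents of \<open>z\<close> and \<open>kb\<close> those of \<open>zbar\<close>. A formal
  power series in the \<open>2n\<close> independent variables is its family of coefficients; the topology
  that HOL-Analysis puts on this function type is the product topology, i.e. that of
  convergence of each coefficient.
\<close>

type_synonym 'n multiindex = "(nat ^ 'n) \<times> (nat ^ 'n)"

type_synonym 'n series = "'n multiindex \<Rightarrow> complex"

definition mi_deg :: "'n::finite multiindex \<Rightarrow> nat" where
  "mi_deg k = (\<Sum>j\<in>UNIV. fst k $ j + snd k $ j)"

definition mi_prime :: "'n::finite multiindex \<Rightarrow> int ^ 'n" where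
  "mi_prime k = (\<chi> j. int (snd k $ j) - int (fst k $ j))"

definition pairing :: "real ^ 'n \<Rightarrow> int ^ 'n \<Rightarrow> real" where
  "pairing \<omega> q = (\<Sum>j\<in>UNIV. \<omega> $ j * of_int (q $ j))"

definition resonance_lattice :: "real ^ 'n \<Rightarrow> (int ^ 'n) set" where
  "resonance_lattice \<omega> = {q. pairing \<omega> q = 0}"

definition sigma :: "real ^ 'n \<Rightarrow> int ^ 'n \<Rightarrow> real" where
  "sigma \<omega> q = sgn (pairing \<omega> q)"

definition F_diamond :: "'n::finite series set" where
  "F_diamond = {H. \<forall>k. mi_deg k \<le> 2 \<longrightarrow> H k = 0}"

definition N_diamond :: "real ^ 'n \<Rightarrow> 'n series set" where
  "N_diamond \<omega> = {H \<in> F_diamond. \<forall>k. H k \<noteq> 0 \<longrightarrow> mi_prime k \<in> resonance_lattice \<omega>}"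

definition series_add :: "'n::finite series \<Rightarrow> 'n series \<Rightarrow> 'n series" where
  "series_add F G = (\<lambda>k. F k + G k)"

definition series_mult :: "'n::finite series \<Rightarrow> 'n series \<Rightarrow> 'n series" where
  "series_mult F G = (\<lambda>k. \<Sum>(a, b) | a + b = k. F a * G b)"

text \<open>The sum in the Cauchy product is finite, so it is never the default value \<open>0\<close> of an
  infinite sum.\<close>

lemma finite_mi_splittings:
  fixes k :: "'n::finite multiindex"
  shows "finite {(a, b). a + b = k}"
proof -
  have fin: "finite {v :: nat ^ 'n. \<forall>j. v $ j \<le> u $ j}" for u :: "nat ^ 'n"
  proof (rule finite_subset)
    show "{v :: nat ^ 'n. \<forall>j. v $ j \<le> u $ j} \<subseteq> vec_lambda ` Pi\<^sub>E UNIV (\<lambda>j. {..u $ j})"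
    proof
      fix v :: "nat ^ 'n" assume "v \<in> {v. \<forall>j. v $ j \<le> u $ j}"
      then have "vec_nth v \<in> Pi\<^sub>E UNIV (\<lambda>j. {..u $ j})" by auto
      then show "v \<in> vec_lambda ` Pi\<^sub>E UNIV (\<lambda>j. {..u $ j})"
        by (metis image_eqI vec_nth_inverse)
    qed
    show "finite (vec_lambda ` Pi\<^sub>E UNIV (\<lambda>j. {..u $ j}) :: (nat ^ 'n) set)"
      by (intro finite_imageI finite_PiE) auto
  qed
  define B where "B = {v :: nat ^ 'n. \<forall>j. v $ j \<le> fst k $ j} \<times> {v. \<forall>j. v $ j \<le> snd k $ j}"
  have "{(a, b). a + b = k} \<subseteq> B \<times> B"
    by (auto simp: B_def)
  moreover have "finite (B \<times> B)"
    unfolding B_def by (intro finite_cartesian_product fin)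
  ultimately show ?thesis by (rule finite_subset)
qed

definition d_z :: "'n::finite \<Rightarrow> 'n series \<Rightarrow> 'n series" where
  "d_z j F = (\<lambda>k. of_nat (fst k $ j + 1) * F (k + (axis j 1, 0)))"

definition d_zbar :: "'n::finite \<Rightarrow> 'n series \<Rightarrow> 'n series" where
  "d_zbar j F = (\<lambda>k. of_nat (snd k $ j + 1) * F (k + (0, axis j 1)))"

definition poisson :: "'n::finite series \<Rightarrow> 'n series \<Rightarrow> 'n series" where
  "poisson F G = (\<lambda>k. \<i> * (\<Sum>j\<in>UNIV. series_mult (d_zbar j F) (d_z j G) k
                                    - series_mult (d_z j F) (d_zbar j G) k))"

definition H2 :: "real ^ 'n \<Rightarrow> 'n series" where
  "H2 \<omega> = (\<lambda>k. \<Sum>j\<in>UNIV. if k = (axis j 1, axis j 1) then complex_of_real (\<omega> $ j) else 0)"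

definition xi_star :: "real ^ 'n \<Rightarrow> 'n series \<Rightarrow> 'n series" where
  "xi_star \<omega> H = (\<lambda>k. if 3 \<le> mi_deg k
                      then - \<i> * complex_of_real (sigma \<omega> (mi_prime k)) * H k else 0)"

definition is_solution :: "real ^ 'n \<Rightarrow> 'n series \<Rightarrow> (real \<Rightarrow> 'n series) \<Rightarrow> bool" where
  "is_solution \<omega> Hhat H \<longleftrightarrow>
     (\<forall>\<delta>. H \<delta> \<in> F_diamond) \<and>
     H 0 = Hhat \<and>
     (\<forall>\<delta> k. ((\<lambda>t. H t k) has_vector_derivative
               - poisson (xi_star \<omega> (H \<delta>)) (series_add (H2 \<omega>) (H \<delta>)) k) (at \<delta>))"

text \<open>The solution exists on the whole real line and is unique for every initial value in
  \<open>F_diamond\<close>: the coefficient equations are triangular with respect to the degree. Outside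
  \<open>F_diamond\<close> there is no solution and the value of \<open>flow\<close> is irrelevant.\<close>

definition flow :: "real ^ 'n \<Rightarrow> real \<Rightarrow> 'n series \<Rightarrow> 'n series" where
  "flow \<omega> \<delta> Hhat = (THE H. is_solution \<omega> Hhat H) \<delta>"

end

theory Submission
  imports Defs
begin

text \<open>
  Since \<open>{F, H\<^sub>2}\<close> multiplies the coefficient \<open>F\<^sub>k\<close> by \<open>\<i>\<langle>\<omega>, k'\<rangle>\<close>, the coefficient
  equations read \<open>\<partial>\<^sub>\<delta> H\<^sub>k = - \<bar>\<langle>\<omega>, k'\<rangle>\<bar> H\<^sub>k + p\<^sub>k\<close>, where \<open>p\<^sub>k\<close> only involves coefficients of degree
  below that of \<open>k\<close>. Every monomial of \<open>p\<^sub>k\<close> contains a factor \<open>\<sigma> H\<^sub>a\<close>, which vanishes for resonant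
  \<open>a\<close>; so if the nonresonant coefficients of lower degree decay exponentially and the resonant
  ones stay bounded, \<open>p\<^sub>k\<close> decays exponentially. Then \<open>H\<^sub>k\<close> decays exponentially for nonresonant
  \<open>k\<close>, and has an integrable derivative, hence a limit, for resonant \<open>k\<close>.
\<close>

section \<open>Calculus of exponentially decaying functions\<close>

definition exp_decay :: "(real \<Rightarrow> complex) \<Rightarrow> bool" where
  "exp_decay f \<longleftrightarrow> (\<exists>C c. c > 0 \<and> (\<forall>t\<ge>0. norm (f t) \<le> C * exp (- c * t)))"

text \<open>A decay rate may always be lowered. Control from above by \<open>c0\<close> lets two
  rates be compared in sums, and keeps the rate of a forcing term strictly below the
  damping.\<close>

lemma exp_decay_rateE:
  assumes "exp_decay f" "c0 > 0"
  obtains C c where "C \<ge> 0" "c > 0" "c < c0" "\<And>t. t \<ge> 0 \<Longrightarrow> norm (f t) \<le> C * exp (- c * t)"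
proof -
  obtain C c where c: "c > 0" and b: "\<forall>t\<ge>0. norm (f t) \<le> C * exp (- c * t)"
    using assms(1) unfolding exp_decay_def by blast
  have C: "C \<ge> 0" using b[rule_format, of 0] by (simp add: order_trans[OF norm_ge_zero])
  define d where "d = min c (c0 / 2)"
  have "norm (f t) \<le> C * exp (- d * t)" if "t \<ge> 0" for t
  proof -
    have "exp (- c * t) \<le> exp (- d * t)"
      using that by (auto simp: d_def intro!: mult_right_mono)
    then show ?thesis using b that C mult_left_mono order_trans by metis
  qed
  moreover have "d > 0" "d < c0" using c assms(2) by (auto simp: d_def)
  ultimately show ?thesis using that C by blast
qed

lemma exp_decay_zero [simp]: "exp_decay (\<lambda>t. 0)"
  unfolding exp_decay_def by (intro exI[of _ 0] exI[of _ 1]) auto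

lemma exp_decay_mult_bounded:
  assumes "exp_decay f" and "\<And>t. t \<ge> 0 \<Longrightarrow> norm (g t) \<le> B"
  shows "exp_decay (\<lambda>t. f t * g t)"
proof -
  obtain C c where c: "c > 0" and b: "\<forall>t\<ge>0. norm (f t) \<le> C * exp (- c * t)"
    using assms(1) unfolding exp_decay_def by blast
  have "norm (f t * g t) \<le> (C * B) * exp (- c * t)" if "t \<ge> 0" for t
  proof -
    have "norm (f t) * norm (g t) \<le> (C * exp (- c * t)) * B"
      using b assms(2) that by (intro mult_mono) (auto intro: order_trans[OF norm_ge_zero])
    then show ?thesis by (simp add: norm_mult mult_ac)
  qed
  then show ?thesis unfolding exp_decay_def using c by blast
qed

lemma exp_decay_cmult:
  assumes "exp_decay f" shows "exp_decay (\<lambda>t. a * f t)"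
  using exp_decay_mult_bounded[OF assms, of "\<lambda>_. a" "norm a"] by (simp add: mult.commute)

lemma exp_decay_add:
  assumes "exp_decay f" "exp_decay g" shows "exp_decay (\<lambda>t. f t + g t)"
proof -
  obtain C c where c: "c > 0" "C \<ge> 0" and b: "\<And>t. t \<ge> 0 \<Longrightarrow> norm (f t) \<le> C * exp (- c * t)"
    using exp_decay_rateE[OF assms(1) zero_less_one] by metis
  obtain D d where d: "d > 0" "d < c" and e: "\<And>t. t \<ge> 0 \<Longrightarrow> norm (g t) \<le> D * exp (- d * t)"
    using exp_decay_rateE[OF assms(2), of c] c by metis
  have "norm (f t + g t) \<le> (C + D) * exp (- d * t)" if "t \<ge> 0" for t
  proof -
    have "exp (- c * t) \<le> exp (- d * t)"
      using that d by (auto intro!: mult_right_mono)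
    then have "norm (f t) \<le> C * exp (- d * t)"
      using b[OF that] c mult_left_mono order_trans by metis
    then show ?thesis using e[OF that] norm_triangle_ineq[of "f t" "g t"]
      by (simp add: algebra_simps)
  qed
  then show ?thesis unfolding exp_decay_def using d by blast
qed

lemma exp_decay_diff:
  assumes "exp_decay f" "exp_decay g" shows "exp_decay (\<lambda>t. f t - g t)"
  using exp_decay_add[OF assms(1) exp_decay_cmult[OF assms(2), of "-1"]] by simp

lemma exp_decay_sum:
  assumes "\<And>x. x \<in> A \<Longrightarrow> exp_decay (f x)"
  shows "exp_decay (\<lambda>t. \<Sum>x\<in>A. f x t)"
  using assms by (induction A rule: infinite_finite_induct) (auto intro: exp_decay_add)

lemma exp_decay_tendsto_0:
  assumes "exp_decay f" shows "(f \<longlongrightarrow> 0) at_top"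
proof -
  obtain C c where c: "c > 0" and b: "\<forall>t\<ge>0. norm (f t) \<le> C * exp (- c * t)"
    using assms unfolding exp_decay_def by blast
  have "filterlim (\<lambda>t. - c * t) at_bot at_top"
    using c by (intro filterlim_tendsto_neg_mult_at_bot[OF tendsto_const _ filterlim_ident]) auto
  then have "((\<lambda>t. C * exp (- c * t)) \<longlongrightarrow> C * 0) at_top"
    by (intro tendsto_intros filterlim_compose[OF exp_at_bot])
  then have "((\<lambda>t. C * exp (- c * t)) \<longlongrightarrow> 0) at_top" by simp
  then show ?thesis
    by (rule Lim_null_comparison[rotated])
       (use b in \<open>auto simp: eventually_at_top_linorder intro!: exI[of _ 0]\<close>)
qed

section \<open>Scalar linear equations with damping and forcing\<close>

text \<open>Mean value inequality against \<open>C / m * exp (m * t)\<close>, an antiderivative of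
  the bound. Positive \<open>m\<close> serves growth after multiplication by an integrating factor,
  negative \<open>m\<close> serves tail estimates.\<close>

lemma norm_diff_le_exp:
  fixes z :: "real \<Rightarrow> complex"
  assumes z: "\<And>t. (z has_vector_derivative p t) (at t)"
    and p: "\<And>t. t \<ge> 0 \<Longrightarrow> norm (p t) \<le> C * exp (m * t)"
    and "m \<noteq> 0" "0 \<le> s" "s \<le> t"
  shows "norm (z t - z s) \<le> C / m * exp (m * t) - C / m * exp (m * s)"
proof (cases "s = t")
  case False
  show ?thesis
  proof (rule differentiable_bound_general)
    show "continuous_on {s..t} z"
      using z by (meson continuous_at_imp_continuous_on has_vector_derivative_continuous)
    show "((\<lambda>t. C / m * exp (m * t)) has_vector_derivative C * exp (m * x)) (at x)" for x
      unfolding has_real_derivative_iff_has_vector_derivative[symmetric]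
      using \<open>m \<noteq> 0\<close> by (auto intro!: derivative_eq_intros)
  qed (use assms False in \<open>auto intro!: continuous_intros\<close>)
qed auto

lemma linear_ode_integrating_factor:
  fixes y :: "real \<Rightarrow> complex" and l :: real
  assumes "(y has_vector_derivative - of_real l * y t + q) (at t)"
  shows "((\<lambda>t. exp (l * t) *\<^sub>R y t) has_vector_derivative exp (l * t) *\<^sub>R q) (at t)"
proof -
  have "((\<lambda>t. exp (l * t)) has_real_derivative l * exp (l * t)) (at t)"
    by (auto intro!: derivative_eq_intros)
  from has_vector_derivative_scaleR[OF this assms]
  show ?thesis by (simp add: scaleR_conv_of_real algebra_simps)
qed

text \<open>Variation of constants: \<open>F t - F 0\<close> is the integral of
  \<open>exp (l * s) *\<^sub>R p s\<close> from 0 to \<open>t\<close>.\<close>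

lemma linear_ode_exists:
  fixes p :: "real \<Rightarrow> complex" and l :: real
  assumes "continuous_on UNIV p"
  shows "\<exists>y. y 0 = y0 \<and> (\<forall>t. (y has_vector_derivative - of_real l * y t + p t) (at t))"
proof -
  have "continuous_on UNIV (\<lambda>t. exp (l * t) *\<^sub>R p t)"
    by (intro continuous_intros assms)
  then have "\<And>t. isCont (\<lambda>t. exp (l * t) *\<^sub>R p t) t"
    by (simp add: continuous_on_eq_continuous_at)
  then obtain F where F: "\<And>t. (F has_vector_derivative exp (l * t) *\<^sub>R p t) (at t)"
    using einterval_antiderivative[of "-\<infinity>" \<infinity> "\<lambda>t. exp (l * t) *\<^sub>R p t"] by auto
  define y where "y = (\<lambda>t. exp (- l * t) *\<^sub>R (y0 + (F t - F 0)))"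
  have "(y has_vector_derivative - of_real l * y t + p t) (at t)" for t
  proof -
    have 1: "((\<lambda>t. exp (- l * t)) has_real_derivative - l * exp (- l * t)) (at t)"
      by (auto intro!: derivative_eq_intros)
    have 2: "((\<lambda>t. y0 + (F t - F 0)) has_vector_derivative exp (l * t) *\<^sub>R p t) (at t)"
      by (auto intro!: derivative_eq_intros F)
    have e: "exp (- l * t) * exp (l * t) = 1" by (simp add: exp_minus)
    have "exp (- l * t) *\<^sub>R exp (l * t) *\<^sub>R p t = p t"
      unfolding scaleR_scaleR e by simp
    moreover have "(- l * exp (- l * t)) *\<^sub>R (y0 + (F t - F 0)) = - of_real l * y t"
      by (simp add: y_def scaleR_conv_of_real)
    ultimately show ?thesis
      using has_vector_derivative_scaleR[OF 1 2] unfolding y_def by (metis add.commute)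
  qed
  then show ?thesis by (intro exI[of _ y]) (auto simp: y_def)
qed

text \<open>The difference solves the homogeneous equation, so its product with the integrating
  factor is constant.\<close>

lemma linear_ode_unique:
  fixes y w :: "real \<Rightarrow> complex" and l :: real
  assumes "\<And>t. (y has_vector_derivative - of_real l * y t + p t) (at t)"
    and "\<And>t. (w has_vector_derivative - of_real l * w t + p t) (at t)"
    and "y 0 = w 0"
  shows "y t = w t"
proof -
  have "((\<lambda>t. y t - w t) has_vector_derivative - of_real l * (y t - w t) + 0) (at t)" for t
    using has_vector_derivative_diff[OF assms(1,2)] by (simp add: algebra_simps)
  from linear_ode_integrating_factor[OF this]
  have "((\<lambda>t. exp (l * t) *\<^sub>R (y t - w t)) has_vector_derivative 0) (at t)" for t
    by simp
  then obtain c where "\<And>t. exp (l * t) *\<^sub>R (y t - w t) = c"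
    using has_vector_derivative_zero_constant[of UNIV "\<lambda>t. exp (l * t) *\<^sub>R (y t - w t)"] by auto
  from this[of 0] this[of t] assms(3) show ?thesis by simp
qed

text \<open>With a forcing rate \<open>c < l\<close>, the function
  \<open>exp (l * t) *\<^sub>R y t\<close> grows at most like \<open>exp ((l - c) * t)\<close>.
  Undoing the factor leaves the rate \<open>c\<close>. Strictness excludes the case
  \<open>l = c\<close>, where an extra factor \<open>t\<close> would appear.\<close>

lemma linear_ode_decay:
  fixes y p :: "real \<Rightarrow> complex" and l :: real
  assumes y: "\<And>t. (y has_vector_derivative - of_real l * y t + p t) (at t)"
    and p: "exp_decay p" and l: "l > 0"
  shows "exp_decay y"
proof -
  obtain C c where C: "C \<ge> 0" "c > 0" "c < l" "\<And>t. t \<ge> 0 \<Longrightarrow> norm (p t) \<le> C * exp (- c * t)"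
    using exp_decay_rateE[OF p l] by blast
  define z where "z = (\<lambda>t. exp (l * t) *\<^sub>R y t)"
  have z: "(z has_vector_derivative exp (l * t) *\<^sub>R p t) (at t)" for t
    unfolding z_def by (rule linear_ode_integrating_factor[OF y])
  have pe: "norm (exp (l * t) *\<^sub>R p t) \<le> C * exp ((l - c) * t)" if "t \<ge> 0" for t
  proof -
    have "norm (exp (l * t) *\<^sub>R p t) \<le> exp (l * t) * (C * exp (- c * t))"
      using C(4)[OF that] by simp
    also have "\<dots> = C * exp ((l - c) * t)"
      by (simp add: left_diff_distrib exp_diff exp_minus field_simps)
    finally show ?thesis .
  qed
  have "norm (y t) \<le> (norm (y 0) + C / (l - c)) * exp (- c * t)" if t: "t \<ge> 0" for t
  proof -
    have "norm (z t - z 0) \<le> C / (l - c) * exp ((l - c) * t) - C / (l - c) * exp ((l - c) * 0)"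
      by (rule norm_diff_le_exp[OF z pe]) (use C t in auto)
    moreover have "C / (l - c) \<ge> 0" using C by simp
    moreover have "norm (z t) \<le> norm (z t - z 0) + norm (z 0)"
      by (metis diff_add_cancel norm_triangle_ineq)
    \<comment> \<open>The initial value is absorbed into the growing exponential, which is at least
      1 for \<open>t \<ge> 0\<close>.\<close>
    moreover have "norm (z 0) \<le> norm (z 0) * exp ((l - c) * t)"
      using C t by (simp add: mult_le_cancel_left1)
    ultimately have "norm (z t) \<le> (norm (z 0) + C / (l - c)) * exp ((l - c) * t)"
      by (simp add: algebra_simps)
    then have "exp (- l * t) * norm (z t) \<le> exp (- l * t) * ((norm (z 0) + C / (l - c)) * exp ((l - c) * t))"
      by (rule mult_left_mono) simp
    moreover have "exp (- l * t) * norm (z t) = norm (y t)"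
      by (simp add: z_def exp_minus)
    moreover have "exp (- l * t) * (K * exp ((l - c) * t)) = K * exp (- c * t)" for K
    proof -
      have "exp (- l * t) * exp ((l - c) * t) = exp (- c * t)"
        by (simp add: exp_add[symmetric] algebra_simps)
      then show ?thesis by (metis mult.left_commute)
    qed
    moreover have "z 0 = y 0" by (simp add: z_def)
    ultimately show ?thesis by metis
  qed
  then show ?thesis unfolding exp_decay_def using C by blast
qed

text \<open>The derivative is integrable at infinity: all increments after time \<open>s\<close> are
  bounded by the tail \<open>C / c * exp (- c * s)\<close>. This gives boundedness from
  \<open>s = 0\<close> and the Cauchy property as \<open>s\<close> grows.\<close>

lemma exp_decay_derivative_tendsto:
  fixes y p :: "real \<Rightarrow> complex"
  assumes y: "\<And>t. (y has_vector_derivative p t) (at t)" and p: "exp_decay p"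
  shows "\<exists>L. (y \<longlongrightarrow> L) at_top" "\<exists>B. \<forall>t\<ge>0. norm (y t) \<le> B"
proof -
  obtain C c where C: "C \<ge> 0" "c > 0" "\<And>t. t \<ge> 0 \<Longrightarrow> norm (p t) \<le> C * exp (- c * t)"
    using exp_decay_rateE[OF p zero_less_one] by metis
  have le: "norm (y t - y s) \<le> C / c * exp (- c * s)" if "0 \<le> s" "s \<le> t" for s t
  proof -
    have "norm (y t - y s) \<le> C / (- c) * exp (- c * t) - C / (- c) * exp (- c * s)"
      by (rule norm_diff_le_exp[OF y C(3)]) (use C that in auto)
    moreover have "C / c * exp (- c * t) \<ge> 0" using C by simp
    ultimately show ?thesis by simp
  qed
  have lim: "((\<lambda>s. C / c * exp (- c * s)) \<longlongrightarrow> 0) at_top"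
  proof -
    have "exp_decay (\<lambda>s. of_real (C / c * exp (- c * s)))"
      unfolding exp_decay_def using C
      by (intro exI[of _ "C / c"] exI[of _ c]) (auto simp: norm_mult norm_divide)
    from exp_decay_tendsto_0[OF this] show ?thesis
      by (metis of_real_0 tendsto_of_real_iff)
  qed
  have "norm (y t) \<le> C / c + norm (y 0)" if "t \<ge> 0" for t
  proof -
    have "norm (y t) \<le> norm (y t - y 0) + norm (y 0)"
      by (metis diff_add_cancel norm_triangle_ineq)
    then show ?thesis using le[of 0 t] that by simp
  qed
  then show "\<exists>B. \<forall>t\<ge>0. norm (y t) \<le> B" by blast
  \<comment> \<open>The limit is found along integer times first. Letting \<open>n\<close> tend to
    infinity in the tail bound at fixed real \<open>s\<close> then extends convergence to all
    times.\<close>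
  have "Cauchy (\<lambda>n. y (real n))"
  proof (rule CauchyI')
    fix e :: real assume "e > 0"
    from order_tendstoD(2)[OF filterlim_compose[OF lim filterlim_real_sequentially] this]
    obtain M where M: "C / c * exp (- c * real n) < e" if "n \<ge> M" for n
      unfolding eventually_sequentially by blast
    have "dist (y (real m)) (y (real n)) < e" if "m \<ge> M" "n > m" for m n
      using le[of "real m" "real n"] M[of m] that by (simp add: dist_norm norm_minus_commute)
    then show "\<exists>M. \<forall>m\<ge>M. \<forall>n>m. dist (y (real m)) (y (real n)) < e" by blast
  qed
  then obtain L where L: "(\<lambda>n. y (real n)) \<longlonglongrightarrow> L"
    using Cauchy_convergent convergent_def by blast
  have "norm (y s - L) \<le> C / c * exp (- c * s)" if s: "s \<ge> 0" for s
  proof (rule tendsto_upperbound)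
    show "(\<lambda>n. norm (y s - y (real n))) \<longlonglongrightarrow> norm (y s - L)"
      by (intro tendsto_intros L)
    show "\<forall>\<^sub>F n in sequentially. norm (y s - y (real n)) \<le> C / c * exp (- c * s)"
      using eventually_ge_at_top[of "nat \<lceil>s\<rceil>"]
      by eventually_elim (use le s in \<open>auto simp: norm_minus_commute nat_le_iff ceiling_le_iff\<close>)
  qed simp
  then have "((\<lambda>s. y s - L) \<longlongrightarrow> 0) at_top"
    by (intro Lim_null_comparison[OF _ lim])
       (auto simp: eventually_at_top_linorder intro!: exI[of _ 0])
  then show "\<exists>L. (y \<longlongrightarrow> L) at_top"
    using Lim_null by blast
qed

section \<open>Degree count in the Poisson bracket\<close>

lemma mi_deg_add: "mi_deg (a + b) = mi_deg a + mi_deg b"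
  by (simp add: mi_deg_def sum.distrib)

lemma mi_deg_unit [simp]: "mi_deg (axis j 1, 0) = 1" "mi_deg (0, axis j 1) = 1"
  by (simp_all add: mi_deg_def axis_def)

lemma poisson_expand:
  "poisson F G k = \<i> * (\<Sum>j\<in>UNIV.
     (\<Sum>(a, b) | a + b = k. of_nat (snd a $ j + 1) * of_nat (fst b $ j + 1)
        * (F (a + (0, axis j 1)) * G (b + (axis j 1, 0)))) -
     (\<Sum>(a, b) | a + b = k. of_nat (fst a $ j + 1) * of_nat (snd b $ j + 1)
        * (F (a + (axis j 1, 0)) * G (b + (0, axis j 1)))))"
  by (simp only: poisson_def series_mult_def d_z_def d_zbar_def mult_ac)

lemma F_diamondD: "F \<in> F_diamond \<Longrightarrow> mi_deg k \<le> 2 \<Longrightarrow> F k = 0"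
  unfolding F_diamond_def by blast

text \<open>Each of the two derivatives lowers a degree by one, so the factors contributing to the
  coefficient \<open>k\<close> have total degree \<open>mi_deg k + 2\<close>.\<close>

lemma mi_deg_splitting:
  assumes "x \<in> {(a, b). a + b = k}"
  shows "mi_deg (fst x + (0, axis j 1)) + mi_deg (snd x + (axis j 1, 0)) = mi_deg k + 2"
    and "mi_deg (fst x + (axis j 1, 0)) + mi_deg (snd x + (0, axis j 1)) = mi_deg k + 2"
proof -
  have "mi_deg k = mi_deg (fst x) + mi_deg (snd x)"
    using assms mi_deg_add by (metis (mono_tags, lifting) case_prod_unfold mem_Collect_eq)
  then show "mi_deg (fst x + (0, axis j 1)) + mi_deg (snd x + (axis j 1, 0)) = mi_deg k + 2"
    "mi_deg (fst x + (axis j 1, 0)) + mi_deg (snd x + (0, axis j 1)) = mi_deg k + 2"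
    unfolding mi_deg_add mi_deg_unit by simp_all
qed

text \<open>Triangularity: two factors of degree at least 3 and total degree
  \<open>mi_deg k + 2\<close> both have degree below \<open>mi_deg k\<close>. All other products
  vanish in \<open>F_diamond\<close>.\<close>

lemma poisson_truncate:
  assumes "F \<in> F_diamond" "G \<in> F_diamond" "F' \<in> F_diamond" "G' \<in> F_diamond"
    and "\<And>q. mi_deg q < mi_deg k \<Longrightarrow> F q = F' q" "\<And>q. mi_deg q < mi_deg k \<Longrightarrow> G q = G' q"
  shows "poisson F G k = poisson F' G' k"
proof -
  have *: "F a * G b = F' a * G' b" if "mi_deg a + mi_deg b = mi_deg k + 2" for a b
  proof (cases "mi_deg a \<le> 2 \<or> mi_deg b \<le> 2")
    case True
    then show ?thesis using assms(1-4) F_diamondD by (metis mult_zero_left mult_zero_right)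
  next
    case False
    then show ?thesis using that assms(5,6) by auto
  qed
  show ?thesis unfolding poisson_expand split_def
    using mi_deg_splitting[THEN *] by (simp only: split_def cong: sum.cong)
qed

lemma continuous_on_poisson:
  assumes "\<And>q. continuous_on S (\<lambda>t. F t q)" "\<And>q. continuous_on S (\<lambda>t. G t q)"
  shows "continuous_on S (\<lambda>t. poisson (F t) (G t) k)"
  unfolding poisson_expand split_def by (intro continuous_intros assms)

text \<open>Same degree dichotomy as in \<open>poisson_truncate\<close>. In each surviving product,
  decay of one factor and boundedness of the other suffice.\<close>

lemma exp_decay_poisson:
  assumes "\<And>t. F t \<in> F_diamond" "\<And>t. G t \<in> F_diamond"
    and F: "\<And>q. mi_deg q < mi_deg k \<Longrightarrow> exp_decay (\<lambda>t. F t q)"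
    and G: "\<And>q. mi_deg q < mi_deg k \<Longrightarrow> \<exists>B. \<forall>t\<ge>0. norm (G t q) \<le> B"
  shows "exp_decay (\<lambda>t. poisson (F t) (G t) k)"
proof -
  have *: "exp_decay (\<lambda>t. F t a * G t b)" if "mi_deg a + mi_deg b = mi_deg k + 2" for a b
  proof (cases "mi_deg a \<le> 2 \<or> mi_deg b \<le> 2")
    case True
    then have "(\<forall>t. F t a = 0) \<or> (\<forall>t. G t b = 0)"
      using assms(1,2) F_diamondD by blast
    then show ?thesis by auto
  next
    case False
    with that obtain B where "\<forall>t\<ge>0. norm (G t b) \<le> B" using G[of b] by auto
    then show ?thesis using False that by (intro exp_decay_mult_bounded[OF F]) auto
  qed
  show ?thesis unfolding poisson_expand split_def
    by (intro exp_decay_cmult exp_decay_sum exp_decay_diff *)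
       (simp_all only: mi_deg_splitting split_def)
qed

section \<open>The bracket with the quadratic part\<close>

lemma poisson_add_right:
  "poisson F (series_add A B) k = poisson F A k + poisson F B k"
  unfolding poisson_expand
  by (simp add: series_add_def distrib_left split_def sum.distrib sum_subtractf algebra_simps)

lemma H2_shift:
  fixes b :: "'n::finite multiindex"
  shows "H2 \<omega> (b + (axis j 1, 0)) = (if b = (0, axis j 1) then of_real (\<omega> $ j) else 0)"
    and "H2 \<omega> (b + (0, axis j 1)) = (if b = (axis j 1, 0) then of_real (\<omega> $ j) else 0)"
proof -
  have e: "u + axis j 1 = (axis i 1 :: nat ^ 'n) \<longleftrightarrow> u = 0 \<and> i = j" for u i
  proof
    assume h: "u + axis j 1 = (axis i 1 :: nat ^ 'n)"
    then have "(u + axis j 1) $ j = (axis i 1 :: nat ^ 'n) $ j" by simp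
    then have "i = j" by (auto simp: axis_def split: if_splits)
    then show "u = 0 \<and> i = j" using h by simp
  qed auto
  have "b + (axis j 1, 0) = (axis i 1, axis i 1) \<longleftrightarrow> i = j \<and> b = (0, axis j 1)" for i
    using e[of "fst b" i] by (cases b) auto
  then show "H2 \<omega> (b + (axis j 1, 0)) = (if b = (0, axis j 1) then of_real (\<omega> $ j) else 0)"
    by (simp add: H2_def)
  have "b + (0, axis j 1) = (axis i 1, axis i 1) \<longleftrightarrow> i = j \<and> b = (axis j 1, 0)" for i
    using e[of "snd b" i] by (cases b) auto
  then show "H2 \<omega> (b + (0, axis j 1)) = (if b = (axis j 1, 0) then of_real (\<omega> $ j) else 0)"
    by (simp add: H2_def)
qed

text \<open>Keeping the remaining index set as \<open>{a. a + u = k}\<close> avoids truncated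
  subtraction; it is empty when \<open>u\<close> does not fit into \<open>k\<close>.\<close>

lemma sum_splittings_delta:
  fixes k u :: "'n::finite multiindex" and w :: complex
  shows "(\<Sum>(a, b) | a + b = k. c a b * (F (a + u) * (if b = u then w else 0)))
           = (\<Sum>a | a + u = k. c a u * (F k * w))"
proof -
  have "(\<Sum>(a, b) | a + b = k. c a b * (F (a + u) * (if b = u then w else 0)))
      = (\<Sum>(a, b) \<in> (\<lambda>a. (a, u)) ` {a. a + u = k}. c a b * (F (a + u) * (if b = u then w else 0)))"
    by (rule sum.mono_neutral_right[OF finite_mi_splittings]) (auto simp del: split_paired_All)
  also have "\<dots> = (\<Sum>a | a + u = k. c a u * (F k * w))"
    by (subst sum.reindex) (auto simp: inj_on_def)
  finally show ?thesis .
qed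

lemma add_unit_eq:
  fixes k :: "'n::finite multiindex"
  shows "{a. a + (0, axis j 1) = k} = (if snd k $ j = 0 then {} else {(fst k, snd k - axis j 1)})"
    and "{a. a + (axis j 1, 0) = k} = (if fst k $ j = 0 then {} else {(fst k - axis j 1, snd k)})"
proof -
  have e: "u + axis j 1 = v \<longleftrightarrow> v $ j \<noteq> 0 \<and> u = v - axis j 1" for u v :: "nat ^ 'n"
  proof
    assume "v $ j \<noteq> 0 \<and> u = v - axis j 1"
    then show "u + axis j 1 = v" by (auto simp: vec_eq_iff axis_def)
  qed (auto simp: axis_def)
  show "{a. a + (0, axis j 1) = k} = (if snd k $ j = 0 then {} else {(fst k, snd k - axis j 1)})"
    using e by (cases k) auto
  show "{a. a + (axis j 1, 0) = k} = (if fst k $ j = 0 then {} else {(fst k - axis j 1, snd k)})"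
    using e by (cases k) auto
qed

text \<open>Monomials are eigenvectors of the bracket with \<open>H2\<close>: the two halves
  contribute \<open>snd k $ j\<close> and \<open>fst k $ j\<close> times
  \<open>\<omega> $ j\<close>, and their difference is the entry of
  \<open>mi_prime k\<close>.\<close>

lemma poisson_H2:
  "poisson F (H2 \<omega>) k = \<i> * of_real (pairing \<omega> (mi_prime k)) * F k"
proof -
  \<comment> \<open>The derivative factor at the predecessor of \<open>k\<close> gives back the
    exponent. For exponent 0 the index set is empty and both sides are 0.\<close>
  have pred: "of_nat (m - Suc 0) + 1 = (of_nat m :: complex)" if "m > 0" for m
    using that by (metis Suc_pred add.commute of_nat_Suc)
  have 1: "(\<Sum>(a, b) | a + b = k. of_nat (snd a $ j + 1) * of_nat (fst b $ j + 1)
      * (F (a + (0, axis j 1)) * H2 \<omega> (b + (axis j 1, 0)))) = of_nat (snd k $ j) * (F k * of_real (\<omega> $ j))" for j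
    unfolding H2_shift sum_splittings_delta[where F = F] add_unit_eq by (simp add: pred add.commute)
  have 2: "(\<Sum>(a, b) | a + b = k. of_nat (fst a $ j + 1) * of_nat (snd b $ j + 1)
      * (F (a + (axis j 1, 0)) * H2 \<omega> (b + (0, axis j 1)))) = of_nat (fst k $ j) * (F k * of_real (\<omega> $ j))" for j
    unfolding H2_shift sum_splittings_delta[where F = F] add_unit_eq by (simp add: pred add.commute)
  show ?thesis unfolding poisson_expand 1 2
    by (simp add: pairing_def mi_prime_def sum_distrib_left sum_distrib_right algebra_simps sum_subtractf)
qed

section \<open>The coefficient equations\<close>

lemma xi_star_F_diamond: "xi_star \<omega> H \<in> F_diamond"
  by (simp add: F_diamond_def xi_star_def)

text \<open>The term \<open>p\<^sub>k\<close> of the coefficient equation: the part of the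
  right-hand side left after \<open>H2\<close> is split off.\<close>

definition coeff_forcing :: "real ^ 'n \<Rightarrow> 'n series \<Rightarrow> 'n series" where
  "coeff_forcing \<omega> H = (\<lambda>k. - poisson (xi_star \<omega> H) H k)"

definition damping :: "real ^ 'n \<Rightarrow> 'n::finite multiindex \<Rightarrow> real" where
  "damping \<omega> k = \<bar>pairing \<omega> (mi_prime k)\<bar>"

text \<open>The eigenvalue \<open>\<i> * x\<close> of the bracket with \<open>H2\<close> meets the
  factor \<open>- \<i> * sgn x\<close> of \<open>xi_star\<close>. Their product is
  \<open>\<bar>x\<bar>\<close>, so the linear part is damping.\<close>

lemma flow_rhs:
  assumes "H \<in> F_diamond"
  shows "- poisson (xi_star \<omega> H) (series_add (H2 \<omega>) H) k
           = - of_real (damping \<omega> k) * H k + coeff_forcing \<omega> H k"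
proof -
  have "\<i> * of_real (pairing \<omega> (mi_prime k)) * xi_star \<omega> H k = of_real (damping \<omega> k) * H k"
  proof (cases "3 \<le> mi_deg k")
    case True
    have "\<i> * of_real x * (- \<i> * of_real (sgn x) * H k) = of_real \<bar>x\<bar> * H k" for x :: real
    proof -
      have "J * X * (- J * S * h) = - (J * J) * (X * S * h)" for J X S h :: complex
        by (simp add: algebra_simps)
      from this[of \<i>]
      have "\<i> * of_real x * (- \<i> * of_real (sgn x) * H k)
          = - (\<i> * \<i>) * (of_real x * of_real (sgn x) * H k)" .
      then show ?thesis by (simp only: abs_sgn i_squared of_real_mult) simp
    qed
    then show ?thesis using True by (simp only: xi_star_def sigma_def damping_def if_True)
  next
    case False
    \<comment> \<open>In degree at most 2 \<open>xi_star\<close> takes its default value 0, which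
      agrees with the right side only because \<open>H\<close> vanishes there.\<close>
    then have "H k = 0" using F_diamondD[OF assms] by simp
    then show ?thesis by (simp add: xi_star_def)
  qed
  then show ?thesis by (simp add: poisson_add_right poisson_H2 coeff_forcing_def)
qed

lemma is_solution_iff:
  "is_solution \<omega> Hhat H \<longleftrightarrow> (\<forall>t. H t \<in> F_diamond) \<and> H 0 = Hhat \<and>
     (\<forall>t k. ((\<lambda>t. H t k) has_vector_derivative
        - of_real (damping \<omega> k) * H t k + coeff_forcing \<omega> (H t) k) (at t))"
  unfolding is_solution_def using flow_rhs by (metis (no_types, lifting))

lemma coeff_forcing_truncate:
  assumes "G \<in> F_diamond" "H \<in> F_diamond" "\<And>q. mi_deg q < mi_deg k \<Longrightarrow> G q = H q"
  shows "coeff_forcing \<omega> G k = coeff_forcing \<omega> H k"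
  unfolding coeff_forcing_def
  by (intro arg_cong[where f = uminus] poisson_truncate assms xi_star_F_diamond)
     (simp_all add: xi_star_def assms(3))

lemma continuous_on_coeff_forcing:
  assumes "\<And>q. continuous_on S (\<lambda>t. H t q)"
  shows "continuous_on S (\<lambda>t. coeff_forcing \<omega> (H t) k)"
proof -
  have "continuous_on S (\<lambda>t. xi_star \<omega> (H t) q)" for q
    unfolding xi_star_def by (cases "3 \<le> mi_deg q") (auto intro!: continuous_intros assms)
  then show ?thesis unfolding coeff_forcing_def
    by (intro continuous_intros continuous_on_poisson assms)
qed

section \<open>Existence and uniqueness of the flow, degree by degree\<close>

text \<open>Induction on the degree: once lower coefficients agree, so do the forcings, and both
  coefficients solve one scalar linear problem.\<close>

lemma is_solution_unique:
  assumes "is_solution \<omega> Hhat G" "is_solution \<omega> Hhat H"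
  shows "G = H"
proof -
  have "\<forall>t. G t k = H t k" for k
  proof (induction "mi_deg k" arbitrary: k rule: less_induct)
    case less
    have "coeff_forcing \<omega> (G t) k = coeff_forcing \<omega> (H t) k" for t
      using assms less by (intro coeff_forcing_truncate) (auto simp: is_solution_def)
    then have G: "((\<lambda>t. G t k) has_vector_derivative
        - of_real (damping \<omega> k) * G t k + coeff_forcing \<omega> (H t) k) (at t)" for t
      using assms(1) unfolding is_solution_iff by metis
    have H: "((\<lambda>t. H t k) has_vector_derivative
        - of_real (damping \<omega> k) * H t k + coeff_forcing \<omega> (H t) k) (at t)" for t
      using assms(2) unfolding is_solution_iff by blast
    have "G 0 k = H 0 k" using assms by (simp add: is_solution_def)
    from linear_ode_unique[where y = "\<lambda>t. G t k" and w = "\<lambda>t. H t k", OF G H this]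
    show ?case by blast
  qed
  then show ?thesis by (intro ext) blast
qed

definition linear_ode_sol :: "real \<Rightarrow> complex \<Rightarrow> (real \<Rightarrow> complex) \<Rightarrow> real \<Rightarrow> complex" where
  "linear_ode_sol l y0 p =
     (SOME y. y 0 = y0 \<and> (\<forall>t. (y has_vector_derivative - of_real l * y t + p t) (at t)))"

lemma linear_ode_sol:
  assumes "continuous_on UNIV p"
  shows "linear_ode_sol l y0 p 0 = y0"
    and "(linear_ode_sol l y0 p has_vector_derivative - of_real l * linear_ode_sol l y0 p t + p t) (at t)"
  using someI_ex[OF linear_ode_exists[OF assms, of y0 l]] unfolding linear_ode_sol_def by blast+

text \<open>The stage \<open>m\<close> carries the coefficients of degree below \<open>m\<close>; the others are still zero.\<close>

primrec sol_upto :: "real ^ 'n \<Rightarrow> 'n series \<Rightarrow> nat \<Rightarrow> real \<Rightarrow> 'n series" where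
  "sol_upto \<omega> Hhat 0 = (\<lambda>t k. 0)"
| "sol_upto \<omega> Hhat (Suc m) = (\<lambda>t k.
     if mi_deg k = m \<and> 3 \<le> m
     then linear_ode_sol (damping \<omega> k) (Hhat k) (\<lambda>s. coeff_forcing \<omega> (sol_upto \<omega> Hhat m s) k) t
     else sol_upto \<omega> Hhat m t k)"

lemma sol_upto_F_diamond: "sol_upto \<omega> Hhat m t \<in> F_diamond"
  by (induction m) (auto simp: F_diamond_def)

text \<open>Continuity of each stage makes the forcing of the next one continuous, so that
  \<open>linear_ode_sol\<close> really is a solution.\<close>

lemma continuous_on_sol_upto: "continuous_on UNIV (\<lambda>t. sol_upto \<omega> Hhat m t k)"
proof (induction m arbitrary: k)
  case (Suc m)
  have "continuous_on UNIV (linear_ode_sol (damping \<omega> k) (Hhat k)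
          (\<lambda>s. coeff_forcing \<omega> (sol_upto \<omega> Hhat m s) k))"
    by (intro continuous_at_imp_continuous_on ballI
          has_vector_derivative_continuous[OF linear_ode_sol(2)] continuous_on_coeff_forcing Suc)
  with Suc[of k] show ?case by (cases "mi_deg k = m \<and> 3 \<le> m") auto
qed simp

text \<open>The step from stage \<open>m\<close> to \<open>Suc m\<close> alters only coefficients of
  degree \<open>m\<close>.\<close>

lemma sol_upto_stable:
  assumes "mi_deg k < m" shows "sol_upto \<omega> Hhat m t k = sol_upto \<omega> Hhat (Suc (mi_deg k)) t k"
proof -
  have "Suc (mi_deg k) \<le> m" using assms by simp
  then show ?thesis by (induction m rule: dec_induct) auto
qed

lemma is_solution_exists:
  assumes "Hhat \<in> F_diamond"
  shows "is_solution \<omega> Hhat (\<lambda>t k. sol_upto \<omega> Hhat (Suc (mi_deg k)) t k)"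
    (is "is_solution \<omega> Hhat ?H")
proof -
  have F: "?H t \<in> F_diamond" for t
    unfolding F_diamond_def using F_diamondD[OF sol_upto_F_diamond] by blast
  have low: "?H t k = 0" if "mi_deg k < 3" for t k
    using F_diamondD[OF F] that by simp
  \<comment> \<open>The forcing sees lower degrees only, so it equals the one from which the
    coefficient \<open>k\<close> was constructed.\<close>
  have forc: "coeff_forcing \<omega> (?H t) k = coeff_forcing \<omega> (sol_upto \<omega> Hhat (mi_deg k) t) k" for t k
    by (rule coeff_forcing_truncate[OF F sol_upto_F_diamond]) (metis sol_upto_stable)
  note cont = continuous_on_coeff_forcing
    [where H = "sol_upto \<omega> Hhat m" for m, OF continuous_on_sol_upto]
  have init: "?H 0 k = Hhat k" for k
  proof (cases "mi_deg k < 3")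
    case True
    then show ?thesis using low[OF True, of 0] F_diamondD[OF assms, of k] by simp
  next
    case False
    then show ?thesis using linear_ode_sol(1)[OF cont] by auto
  qed
  have deriv: "((\<lambda>t. ?H t k) has_vector_derivative
        - of_real (damping \<omega> k) * ?H t k + coeff_forcing \<omega> (?H t) k) (at t)" for t k
  proof (cases "mi_deg k < 3")
    case True
    \<comment> \<open>Below degree 3 comparison with the zero series makes the forcing vanish, and
      the equation is trivial.\<close>
    have "coeff_forcing \<omega> (?H t) k = coeff_forcing \<omega> (\<lambda>q. 0) k"
      using True low by (intro coeff_forcing_truncate[OF F]) (auto simp: F_diamond_def)
    then have "coeff_forcing \<omega> (?H t) k = 0"
      by (simp add: coeff_forcing_def poisson_expand)
    then show ?thesis using low[OF True] by simp
  next
    case False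
    then have e: "(\<lambda>t. ?H t k) = linear_ode_sol (damping \<omega> k) (Hhat k)
        (\<lambda>s. coeff_forcing \<omega> (sol_upto \<omega> Hhat (mi_deg k) s) k)" by auto
    show ?thesis unfolding forc fun_cong[OF e] e by (rule linear_ode_sol(2)[OF cont])
  qed
  show ?thesis unfolding is_solution_iff using F init deriv by blast
qed

lemma is_solution_flow:
  assumes "Hhat \<in> F_diamond"
  shows "is_solution \<omega> Hhat (\<lambda>\<delta>. flow \<omega> \<delta> Hhat)"
  unfolding flow_def
  using theI[of "is_solution \<omega> Hhat", OF is_solution_exists[OF assms]
      is_solution_unique[OF _ is_solution_exists[OF assms]]]
  by simp

section \<open>Asymptotics of the coefficients and the limit\<close>

text \<open>The induction on degree feeds on two of the claims: decay of nonresonant coefficients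
  controls the factor \<open>xi_star \<omega> (H t)\<close> of the bracket, boundedness of all
  coefficients controls the factor \<open>H t\<close>.\<close>

lemma solution_asymptotics:
  assumes "is_solution \<omega> Hhat H"
  shows "(\<exists>B. \<forall>t\<ge>0. norm (H t k) \<le> B) \<and> (\<exists>L. ((\<lambda>t. H t k) \<longlongrightarrow> L) at_top) \<and>
         (pairing \<omega> (mi_prime k) \<noteq> 0 \<longrightarrow> exp_decay (\<lambda>t. H t k))"
proof (induction "mi_deg k" arbitrary: k rule: less_induct)
  case less
  have F: "H t \<in> F_diamond" for t using assms by (simp add: is_solution_def)
  have ode: "((\<lambda>t. H t k) has_vector_derivative
        - of_real (damping \<omega> k) * H t k + coeff_forcing \<omega> (H t) k) (at t)" for t
    using assms unfolding is_solution_iff by blast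
  have xi: "exp_decay (\<lambda>t. xi_star \<omega> (H t) q)" if "mi_deg q < mi_deg k" for q
  proof (cases "3 \<le> mi_deg q \<and> pairing \<omega> (mi_prime q) \<noteq> 0")
    case True
    then have "exp_decay (\<lambda>t. H t q)" using less[OF that] by blast
    then show ?thesis using True unfolding xi_star_def by (simp only: if_True exp_decay_cmult)
  next
    case False
    \<comment> \<open>At resonant indices \<open>sigma\<close> is \<open>sgn 0 = 0\<close>, so
      coefficients that need not decay drop out.\<close>
    then have "(\<lambda>t. xi_star \<omega> (H t) q) = (\<lambda>t. 0)"
      by (auto simp: xi_star_def sigma_def)
    then show ?thesis by simp
  qed
  have "exp_decay (\<lambda>t. poisson (xi_star \<omega> (H t)) (H t) k)"
    using less by (intro exp_decay_poisson xi_star_F_diamond F xi) auto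
  from exp_decay_cmult[OF this, of "-1"]
  have forc: "exp_decay (\<lambda>t. coeff_forcing \<omega> (H t) k)"
    by (simp add: coeff_forcing_def)
  show ?case
  proof (cases "pairing \<omega> (mi_prime k) = 0")
    case True
    \<comment> \<open>Resonance means zero damping: the derivative is the decaying forcing
      alone.\<close>
    then have "((\<lambda>t. H t k) has_vector_derivative coeff_forcing \<omega> (H t) k) (at t)" for t
      using ode[of t] by (simp add: damping_def)
    from exp_decay_derivative_tendsto[OF this forc] True show ?thesis by simp
  next
    case False
    then have d: "exp_decay (\<lambda>t. H t k)"
      by (intro linear_ode_decay[OF ode forc]) (simp add: damping_def)
    then obtain C c where c: "C \<ge> 0" "c > 0" "\<And>t. t \<ge> 0 \<Longrightarrow> norm (H t k) \<le> C * exp (- c * t)"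
      using exp_decay_rateE[OF d zero_less_one] by metis
    have "norm (H t k) \<le> C" if "t \<ge> 0" for t
    proof -
      have "C * exp (- c * t) \<le> C * 1" using c that by (intro mult_left_mono) auto
      then show ?thesis using c(3)[OF that] by simp
    qed
    then show ?thesis using d exp_decay_tendsto_0 by blast
  qed
qed

lemma tendsto_fun_iff:
  fixes f :: "'a \<Rightarrow> 'b \<Rightarrow> 'c::topological_space"
  shows "(f \<longlongrightarrow> L) F \<longleftrightarrow> (\<forall>i. ((\<lambda>x. f x i) \<longlongrightarrow> L i) F)"
  using limitin_componentwise[of "\<lambda>_. euclidean :: 'c topology" UNIV f L F]
  by (simp add: euclidean_product_topology)

theorem corollary4p1:
  fixes \<omega> :: "real ^ 'n" and Hhat :: "'n series"
  assumes "Hhat \<in> F_diamond"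
  shows "\<exists>L \<in> N_diamond \<omega>. ((\<lambda>\<delta>. flow \<omega> \<delta> Hhat) \<longlongrightarrow> L) at_top"
proof -
  note sol = is_solution_flow[OF assms, of \<omega>]
  \<comment> \<open>The limit series is assembled from the limits of the single
    coefficients.\<close>
  obtain L where L: "\<And>k. ((\<lambda>\<delta>. flow \<omega> \<delta> Hhat k) \<longlongrightarrow> L k) at_top"
    using solution_asymptotics[OF sol] by metis
  have L0: "L k = 0" if "((\<lambda>\<delta>. flow \<omega> \<delta> Hhat k) \<longlongrightarrow> 0) at_top" for k
    using tendsto_unique[OF _ L that] by simp
  have "L k = 0" if "mi_deg k \<le> 2" for k
  proof (rule L0)
    have "flow \<omega> \<delta> Hhat k = 0" for \<delta>
      using sol that F_diamondD unfolding is_solution_def by blast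
    then show "((\<lambda>\<delta>. flow \<omega> \<delta> Hhat k) \<longlongrightarrow> 0) at_top" by simp
  qed
  \<comment> \<open>Nonresonant coefficients decay, so only resonant ones survive in the limit; this
    is membership in \<open>N_diamond\<close> by contraposition.\<close>
  moreover have "L k = 0" if "pairing \<omega> (mi_prime k) \<noteq> 0" for k
    using solution_asymptotics[OF sol, of k] that by (intro L0 exp_decay_tendsto_0) simp
  ultimately have "L \<in> N_diamond \<omega>"
    by (auto simp: N_diamond_def F_diamond_def resonance_lattice_def)
  then show ?thesis using L tendsto_fun_iff by blast
qed

end
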